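(* Let $s \geq 1$ and $t \geq 2$ be integers and let $\alpha_{s,t}$ be the type-$\alpha$ comb with $s$ teeth of length $t$. Then the number of linear extensions of $\alpha_{s,t}$ that avoid both patterns $213$ and $231$ equals $2^{s-1}$.
   Context: A linear extension of a finite poset $P$ on a set of integers is a listing $v=[v_1,\dots,v_n]$ of all elements of $P$, each exactly once, such that whenever $a \leq_P b$, $a$ appears before $b$. For $w \in S_3$, a sequence $v$ of distinct integers contains $w$ if there are indices $i<j<k$ with $(v_i,v_j,v_k)$ in the same relative order as $(w_1,w_2,w_3)$; otherwise $v$ avoids $w$. The type-$\alpha$ comb $\alpha_{s,t}$ is the poset on $\{1,\dots,st\}$ whose order is generated by the relations $i \leq i+1$ for $1 \leq i \leq s-1$ (the spine $1,\dots,s$) and $x \leq x+s$ for $1 \leq x \leq (t-1)s$ (so the teeth are $c, c+s, \dots, c+(t-1)s$ for $1\le c\le s$). *)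

theory Defs
  imports Main
begin

text \<open>
  A poset is given by a carrier \<open>A\<close> and a reflexive order relation \<open>r\<close> on it, as in
  \<^const>\<open>partial_order_on\<close>. Since \<open>r\<close> is reflexive, ``\<open>a\<close> appears before \<open>b\<close>'' is demanded only
  for \<open>a \<noteq> b\<close>.
\<close>

definition linear_extension :: "'a set \<Rightarrow> 'a rel \<Rightarrow> 'a list \<Rightarrow> bool" where
  "linear_extension A r v \<longleftrightarrow>
     distinct v \<and> set v = A \<and>
     (\<forall>i < length v. \<forall>j < length v. (v ! i, v ! j) \<in> r \<and> v ! i \<noteq> v ! j \<longrightarrow> i < j)"

definition same_relative_order :: "'a::linorder list \<Rightarrow> 'b::linorder list \<Rightarrow> bool" where
  "same_relative_order xs ys \<longleftrightarrow>
     length xs = length ys \<and>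
     (\<forall>i < length xs. \<forall>j < length xs. xs ! i < xs ! j \<longleftrightarrow> ys ! i < ys ! j)"

text \<open>Patterns \<open>w\<close> of length three, in one-line notation.\<close>

definition contains_pattern :: "'a::linorder list \<Rightarrow> nat list \<Rightarrow> bool" where
  "contains_pattern v w \<longleftrightarrow>
     (\<exists>i j k. i < j \<and> j < k \<and> k < length v \<and> same_relative_order [v ! i, v ! j, v ! k] w)"

abbreviation avoids_pattern :: "'a::linorder list \<Rightarrow> nat list \<Rightarrow> bool" where
  "avoids_pattern v w \<equiv> \<not> contains_pattern v w"

definition comb_carrier :: "nat \<Rightarrow> nat \<Rightarrow> nat set" where
  "comb_carrier s t = {1..s * t}"

definition alpha_comb_gen :: "nat \<Rightarrow> nat \<Rightarrow> nat rel" where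
  "alpha_comb_gen s t =
     {(i, i + 1) | i. 1 \<le> i \<and> i \<le> s - 1} \<union> {(x, x + s) | x. 1 \<le> x \<and> x \<le> (t - 1) * s}"

text \<open>
  The restriction to the carrier only removes the pairs \<open>(x, x)\<close> with \<open>x\<close> outside the carrier.
\<close>

definition alpha_comb :: "nat \<Rightarrow> nat \<Rightarrow> nat rel" where
  "alpha_comb s t = Restr ((alpha_comb_gen s t)\<^sup>*) (comb_carrier s t)"

lemma alpha_comb_gen_carrier:
  assumes "t \<ge> 1"
  shows "alpha_comb_gen s t \<subseteq> comb_carrier s t \<times> comb_carrier s t"
proof -
  obtain u where "t = Suc u" using assms by (cases t) auto
  moreover have "i + 1 \<le> s + s * u" if "1 \<le> i" "i \<le> s - 1" for i
    using that by (simp add: trans_le_add1)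
  ultimately show ?thesis
    by (fastforce simp: alpha_comb_gen_def comb_carrier_def algebra_simps)
qed

lemma alpha_comb_le: "(a, b) \<in> (alpha_comb_gen s t)\<^sup>* \<Longrightarrow> a \<le> b"
  by (induction rule: rtrancl_induct) (auto simp: alpha_comb_gen_def)

lemma partial_order_on_alpha_comb: "partial_order_on (comb_carrier s t) (alpha_comb s t)"
  unfolding partial_order_on_def preorder_on_def
proof (intro conjI)
  show "refl_on (comb_carrier s t) (alpha_comb s t)"
    by (auto simp: refl_on_def alpha_comb_def)
  show "trans (alpha_comb s t)"
    unfolding alpha_comb_def by (auto intro!: transI elim: rtrancl_trans)
  show "antisym (alpha_comb s t)"
    by (auto intro!: antisymI antisym dest: alpha_comb_le simp: alpha_comb_def)
qed (auto simp: alpha_comb_def)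

end

theory Submission imports Defs begin

text \<open>
  A sequence of distinct entries avoids 213 and 231 iff each entry is the minimum or the maximum of
  itself and the entries after it. Let \<open>m = (t - 1) * s\<close>. As long as the entries chosen so
  far are \<open>1, \<dots>, i\<close> with \<open>i < m\<close>, the maximum \<open>s * t\<close> may not come next, because the smaller
  element \<open>m\<close> of its tooth is still missing; so the sequence starts with \<open>1, \<dots>, m\<close>. The remaining
  \<open>s\<close> elements are the tips of the teeth, which are maximal in the poset as \<open>t \<ge> 2\<close>. Hence they may
  follow in any order choosing the minimum or the maximum at each step, and there are \<open>2 ^ (s - 1)\<close>
  such orders.
\<close>

primrec extremal_entries :: "'a::linorder list \<Rightarrow> bool" where
  "extremal_entries [] \<longleftrightarrow> True"
| "extremal_entries (x # xs) \<longleftrightarrow>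
     ((\<forall>y \<in> set xs. x < y) \<or> (\<forall>y \<in> set xs. y < x)) \<and> extremal_entries xs"

text \<open>The count peels off the head of a list, whereas patterns and linear extensions speak of
  positions; this translates between the two views.\<close>

lemma extremal_entries_nth:
  "extremal_entries v \<longleftrightarrow>
     (\<forall>i < length v. (\<forall>j < length v. i < j \<longrightarrow> v ! i < v ! j) \<or> (\<forall>j < length v. i < j \<longrightarrow> v ! j < v ! i))"
  by (induction v) (simp_all add: All_less_Suc2 all_set_conv_all_nth)

text \<open>Each entry of such a prefix is the minimum of what follows it, so the prefix imposes no
  condition. It is applied to the prefix \<open>[1..<m + 1]\<close>.\<close>

lemma extremal_entries_append:
  assumes "sorted_wrt (<) xs" "\<And>x y. x \<in> set xs \<Longrightarrow> y \<in> set ys \<Longrightarrow> x < y"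
  shows "extremal_entries (xs @ ys) \<longleftrightarrow> extremal_entries ys"
  using assms by (induction xs) auto

lemma extremal_entries_appendD: "extremal_entries (xs @ ys) \<Longrightarrow> extremal_entries ys"
  by (induction xs) auto

lemma same_relative_order_213:
  "same_relative_order [a, b, c] [2, 1, 3 :: nat] \<longleftrightarrow> b < a \<and> a < c"
  by (auto simp: same_relative_order_def All_less_Suc2)

lemma same_relative_order_231:
  "same_relative_order [a, b, c] [2, 3, 1 :: nat] \<longleftrightarrow> c < a \<and> a < b"
  by (auto simp: same_relative_order_def All_less_Suc2)

text \<open>213 and 231 are the two patterns that start with their middle value. A non-extremal
  entry has a smaller and a larger entry after it; their order decides which pattern occurs.\<close>

lemma avoids_213_231_iff:
  assumes "distinct v"
  shows "avoids_pattern v [2, 1, 3] \<and> avoids_pattern v [2, 3, 1] \<longleftrightarrow> extremal_entries v"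
proof
  assume av: "avoids_pattern v [2, 1, 3] \<and> avoids_pattern v [2, 3, 1]"
  show "extremal_entries v"
  proof (rule ccontr)
    assume "\<not> extremal_entries v"
    then obtain i j k where *: "i < j" "j < length v" "\<not> v ! i < v ! j"
        "i < k" "k < length v" "\<not> v ! k < v ! i"
      unfolding extremal_entries_nth by blast
    \<comment> \<open>Distinctness makes both comparisons strict. Then \<open>j < k\<close> yields
      213 and \<open>k < j\<close> yields 231.\<close>
    moreover have "v ! j < v ! i" "v ! i < v ! k"
      using * assms by (metis linorder_neqE nth_eq_iff_index_eq order.strict_trans nless_le)+
    moreover from this have "j \<noteq> k" by auto
    ultimately show False
      using av unfolding contains_pattern_def same_relative_order_213 same_relative_order_231
      by (meson linorder_neqE_nat)
  qed
next
  assume "extremal_entries v"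
  then show "avoids_pattern v [2, 1, 3] \<and> avoids_pattern v [2, 3, 1]"
    unfolding contains_pattern_def same_relative_order_213 same_relative_order_231
      extremal_entries_nth
    by (meson less_asym order.strict_trans)
qed

text \<open>The head must be \<open>Min A\<close> or \<open>Max A\<close>, and the tail is any
  extremal arrangement of the remaining elements. Each entry but the last thus doubles the
  count.\<close>

lemma card_extremal_entries:
  fixes A :: "'a::linorder set"
  assumes "finite A" "A \<noteq> {}"
  shows "card {v. distinct v \<and> set v = A \<and> extremal_entries v} = 2 ^ (card A - 1)"
  using assms
proof (induction "card A" arbitrary: A rule: less_induct)
  case less
  define E where "E = (\<lambda>A::'a set. {v. distinct v \<and> set v = A \<and> extremal_entries v})"
  have fin: "finite (E B)" if "finite B" for B
    by (rule finite_subset[OF _ finite_lists_length_le[OF that, of "card B"]])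
      (auto simp: E_def distinct_card)
  show ?case
  \<comment> \<open>For a singleton the minimum and the maximum coincide, so the two choices of head
    are one.\<close>
  proof (cases "card A = 1")
    case True
    then obtain a where a: "A = {a}" by (auto simp: card_1_singleton_iff)
    have "v = [a]" if "distinct v" "set v = {a}" for v
      using that by (cases v) (auto simp: subset_singleton_iff dest: sym)
    then have "E A = {[a]}" by (auto simp: E_def a)
    then show ?thesis using True by (simp add: E_def)
  next
    case False
    with less.prems have c: "card A \<ge> 2"
      by (metis One_nat_def Suc_1 Suc_leI card_gt_0_iff le_neq_implies_less)
    let ?x = "Min A" and ?y = "Max A"
    have mem: "?x \<in> A" "?y \<in> A" using less.prems by auto
    have "?x \<noteq> ?y"
    proof
      assume "?x = ?y"
      then have "A \<subseteq> {?x}" using less.prems by (metis Max_ge Min_le antisym singletonI subsetI)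
      then show False using c card_mono[of "{?x}" A] by simp
    qed
    have split: "E A = (#) ?x ` E (A - {?x}) \<union> (#) ?y ` E (A - {?y})"
    proof (intro equalityI subsetI)
      fix v assume v: "v \<in> E A"
      with mem obtain z zs where zs: "v = z # zs" by (cases v) (auto simp: E_def)
      have "z = ?x \<or> z = ?y"
        using v less.prems
        by (auto simp: E_def zs intro!: Min_eqI[symmetric] Max_eqI[symmetric])
      moreover have "zs \<in> E (A - {z})" using v by (auto simp: E_def zs)
      ultimately show "v \<in> (#) ?x ` E (A - {?x}) \<union> (#) ?y ` E (A - {?y})" using zs by auto
    next
      fix v assume "v \<in> (#) ?x ` E (A - {?x}) \<union> (#) ?y ` E (A - {?y})"
      then obtain z zs where zs: "v = z # zs" "z = ?x \<or> z = ?y" "zs \<in> E (A - {z})" by auto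
      have "?x < u" if "u \<in> A" "u \<noteq> ?x" for u
        using that less.prems by (simp add: order.not_eq_order_implies_strict)
      moreover have "u < ?y" if "u \<in> A" "u \<noteq> ?y" for u
        using that less.prems by (simp add: order.not_eq_order_implies_strict)
      ultimately show "v \<in> E A" using zs mem by (auto simp: E_def)
    qed
    have IH: "card (E (A - {z})) = 2 ^ (card A - 2)" if "z \<in> A" for z
    proof -
      have d: "card (A - {z}) = card A - 1" using that less.prems by simp
      with c have "card (A - {z}) < card A" by linarith
      moreover from c d have "A - {z} \<noteq> {}" by (intro notI) simp
      moreover note less.prems
      ultimately show ?thesis
        using less.hyps[of "A - {z}"] by (simp add: E_def d numeral_2_eq_2)
    qed
    have "card (E A) = card ((#) ?x ` E (A - {?x})) + card ((#) ?y ` E (A - {?y}))"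
      unfolding split by (rule card_Un_disjoint) (use \<open>?x \<noteq> ?y\<close> less.prems fin in auto)
    also have "\<dots> = 2 * 2 ^ (card A - 2)"
      by (simp add: card_image IH mem)
    also have "\<dots> = 2 ^ (card A - 1)"
      using c by (metis One_nat_def Suc_1 Suc_diff_le diff_Suc_Suc power_Suc)
    finally show ?thesis by (simp add: E_def)
  qed
qed

text \<open>A strict relation begins with a generator leaving \<open>a\<close>, and no generator
  leaves a tip, that is, an element above \<open>(t - 1) * s\<close>.\<close>

lemma alpha_comb_less:
  assumes "(a, b) \<in> alpha_comb s t" "a \<noteq> b" "t \<ge> 2"
  shows "a < b" "a \<le> (t - 1) * s"
proof -
  from assms have ab: "(a, b) \<in> (alpha_comb_gen s t)\<^sup>*" by (simp add: alpha_comb_def)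
  then show "a < b" using alpha_comb_le assms(2) by (simp add: order.not_eq_order_implies_strict)
  from ab assms(2) obtain c where "(a, c) \<in> alpha_comb_gen s t" by (meson converse_rtranclE)
  then have "a \<le> s - 1 \<or> a \<le> (t - 1) * s" by (auto simp: alpha_comb_gen_def)
  \<comment> \<open>As teeth have length at least 2, the whole spine lies below the tips.\<close>
  moreover have "1 * s \<le> (t - 1) * s" using assms(3) by (intro mult_le_mono1) linarith
  ultimately show "a \<le> (t - 1) * s" by linarith
qed

lemma linear_extension_alpha_comb_prefix:
  assumes "linear_extension (comb_carrier s t) (alpha_comb s t) v" "extremal_entries v"
    and "s \<ge> 1" "t \<ge> 2" "i < (t - 1) * s"
  shows "v ! i = i + 1"
  using assms(5)
proof (induction i rule: less_induct)
  case (less i)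
  define m where "m = (t - 1) * s"
  from assms have v: "distinct v" "set v = {1..s * t}"
    and lin: "\<And>i j. i < length v \<Longrightarrow> j < length v \<Longrightarrow> (v ! i, v ! j) \<in> alpha_comb s t \<Longrightarrow>
      v ! i \<noteq> v ! j \<Longrightarrow> i < j"
    by (auto simp: linear_extension_def comb_carrier_def)
  have st: "s * t = m + s" using assms by (cases t) (auto simp: m_def)
  have len: "length v = s * t" using v distinct_card by fastforce
  have i: "i < m" "i < length v" using less.prems st len by (auto simp: m_def)
  have pre: "v ! j = j + 1" if "j < i" for j using that less.IH i by (auto simp: m_def)
  \<comment> \<open>Positions before \<open>i\<close> hold exactly the values up to
    \<open>i\<close>, since positions count from 0.\<close>
  have later: "\<exists>k < length v. i \<le> k \<and> v ! k = x" if x: "i < x" "x \<le> s * t" for x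
  proof -
    from x v obtain k where k: "k < length v" "v ! k = x"
      by (metis atLeastAtMost_iff in_set_conv_nth less_one linorder_not_less not_less_zero order_le_less_trans)
    with pre[of k] x show ?thesis by (metis Suc_eq_plus1 linorder_not_less not_less_eq order_less_imp_le)
  qed
  show ?case
  proof (rule ccontr)
    assume ne: "v ! i \<noteq> i + 1"
    obtain k where k: "k < length v" "i \<le> k" "v ! k = i + 1" using later[of "i + 1"] i st by auto
    obtain l where l: "l < length v" "i \<le> l" "v ! l = s * t" using later[of "s * t"] i st by auto
    obtain p where p: "p < length v" "i \<le> p" "v ! p = m" using later[of m] i st by auto
    have "i < k" using k ne le_neq_implies_less by blast
    \<comment> \<open>A value of at most \<open>i\<close> would already stand at position
      \<open>v ! i - 1\<close>.\<close>
    have "i < v ! i"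
    proof (rule ccontr)
      assume "\<not> i < v ! i"
      moreover have "v ! i \<ge> 1" using v i nth_mem[of i v] by auto
      ultimately have "v ! (v ! i - 1) = v ! i" "v ! i - 1 < i" using pre[of "v ! i - 1"] by auto
      then show False using v i by (metis nth_eq_iff_index_eq less_trans nless_le)
    qed
    with ne k have "v ! k < v ! i" by simp
    \<comment> \<open>The smaller entry \<open>i + 1\<close> comes later, so \<open>v ! i\<close> is
      not a minimum and must be a maximum. The largest value \<open>s * t\<close>, not yet used,
      therefore stands at \<open>i\<close>.\<close>
    then have "\<forall>j < length v. i < j \<longrightarrow> v ! j < v ! i"
      using assms(2) i k \<open>i < k\<close> unfolding extremal_entries_nth by (metis less_asym)
    moreover have "v ! i \<le> s * t" using v i nth_mem[of i v] by auto
    ultimately have "l = i" using l by (metis le_neq_implies_less linorder_not_less)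
    \<comment> \<open>Since \<open>s * t = m + s\<close>, the element \<open>m\<close> is just below
      the tip \<open>s * t\<close> in its tooth.\<close>
    have "(m, s * t) \<in> alpha_comb_gen s t"
      unfolding st alpha_comb_gen_def m_def[symmetric] using i by auto
    then have "(v ! p, v ! l) \<in> alpha_comb s t"
      using i p l assms(3) unfolding alpha_comb_def comb_carrier_def st by auto
    then have "p < l" using lin[of p l] p l st assms by auto
    with p \<open>l = i\<close> show False by simp
  qed
qed

lemma extremal_linear_extensions_alpha_comb:
  assumes "s \<ge> 1" "t \<ge> 2"
  defines "m \<equiv> (t - 1) * s"
  shows "{v. linear_extension (comb_carrier s t) (alpha_comb s t) v \<and> extremal_entries v} =
    (@) [1..<m + 1] ` {w. distinct w \<and> set w = {m + 1..m + s} \<and> extremal_entries w}"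
    (is "?L = ?R")
proof (intro equalityI subsetI)
  have st: "s * t = m + s" using assms by (cases t) auto
  {
    fix v assume "v \<in> ?L"
    then have lin: "linear_extension (comb_carrier s t) (alpha_comb s t) v" "extremal_entries v"
      by auto
    then have v: "distinct v" "set v = {1..m + s}"
      by (auto simp: linear_extension_def comb_carrier_def st)
    then have len: "length v = m + s" using distinct_card by fastforce
    have "take m v = [1..<m + 1]"
      by (rule nth_equalityI)
        (use len linear_extension_alpha_comb_prefix[OF lin assms(1,2)] in
          \<open>auto simp: m_def nth_append simp del: upt_Suc\<close>)
    then have eq: "v = [1..<m + 1] @ drop m v" by (metis append_take_drop_id)
    have "distinct (drop m v)" using v by simp
    moreover have "set (drop m v) = {m + 1..m + s}"
    proof -
      have "set (drop m v) \<inter> set [1..<m + 1] = {}" "set (drop m v) \<union> set [1..<m + 1] = {1..m + s}"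
        using v eq by (metis distinct_append inf_commute, metis set_append sup_commute v(2) eq)
      moreover have "set [1..<m + 1] = {1..m}" by auto
      ultimately have "set (drop m v) = {1..m + s} - {1..m}" by blast
      also have "\<dots> = {m + 1..m + s}" by auto
      finally show ?thesis .
    qed
    moreover have "extremal_entries (drop m v)"
      using lin eq extremal_entries_appendD by metis
    ultimately show "v \<in> ?R" using eq by blast
  next
    fix v assume "v \<in> ?R"
    then obtain w where w: "v = [1..<m + 1] @ w" "distinct w" "set w = {m + 1..m + s}"
      "extremal_entries w" by blast
    have ext: "extremal_entries v"
      unfolding w(1) by (subst extremal_entries_append) (use w in \<open>auto simp del: upt_Suc\<close>)
    have v: "distinct v" "set v = comb_carrier s t"
      using w st by (auto simp: comb_carrier_def simp del: upt_Suc)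
    have pre: "v ! i = i + 1" if "i < m" for i
      using that by (simp add: w(1) nth_append del: upt_Suc)
    have suf: "v ! i > m" if "m \<le> i" "i < length v" for i
    proof -
      have "i - m < length w" using that by (simp add: w(1) less_diff_conv2 del: upt_Suc)
      then have "w ! (i - m) \<in> {m + 1..m + s}" using w(3) nth_mem by blast
      with that show ?thesis by (simp add: w(1) nth_append del: upt_Suc)
    qed
    \<comment> \<open>The smaller element of a strict relation is at most \<open>m\<close>, so it
      lies in the increasing prefix. The larger one lies further along the prefix or after
      it.\<close>
    have "i < j" if "i < length v" "j < length v" "(v ! i, v ! j) \<in> alpha_comb s t"
      "v ! i \<noteq> v ! j" for i j
    proof -
      have *: "v ! i < v ! j" "v ! i \<le> m"
        using alpha_comb_less[OF that(3,4) assms(2)] by (auto simp: m_def)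
      then have "i < m" using suf that by (meson linorder_not_less)
      with * pre[of i] pre[of j] show "i < j" by (cases "j < m") auto
    qed
    with v ext show "v \<in> ?L" by (simp add: linear_extension_def)
  }
qed

theorem theorem11:
  fixes s t :: nat
  assumes "s \<ge> 1" and "t \<ge> 2"
  shows "card {v. linear_extension (comb_carrier s t) (alpha_comb s t) v \<and>
                  avoids_pattern v [2, 1, 3] \<and> avoids_pattern v [2, 3, 1]} = 2 ^ (s - 1)"
proof -
  let ?m = "(t - 1) * s"
  have "{v. linear_extension (comb_carrier s t) (alpha_comb s t) v \<and>
            avoids_pattern v [2, 1, 3] \<and> avoids_pattern v [2, 3, 1]} =
        {v. linear_extension (comb_carrier s t) (alpha_comb s t) v \<and> extremal_entries v}"
    using avoids_213_231_iff by (auto simp: linear_extension_def)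
  \<comment> \<open>Prepending the fixed prefix is injective, so only the arrangements of the
    \<open>s\<close> tips are left to count.\<close>
  also have "card \<dots> =
      card {w. distinct w \<and> set w = {?m + 1..?m + s} \<and> extremal_entries w}"
    unfolding extremal_linear_extensions_alpha_comb[OF assms]
    by (rule card_image) (simp add: inj_on_def)
  also have "\<dots> = 2 ^ (s - 1)"
    using assms card_extremal_entries[of "{?m + 1..?m + s}"] by simp
  finally show ?thesis .
qed

end
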